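(* Let $f(z)=\sum_{k=0}^{\infty}\xi_k z^k$, $z\in\mathbb{C}$, where $\{\xi_k\}_{k\ge 0}$ are centered Gaussian distributed complex random variables with $\xi_k=\eta_k+i\zeta_k$, and let $\sigma_k^2=\mathbf{E}\eta_k^2+\mathbf{E}\zeta_k^2$, $\sigma_k\ge 0$. Suppose that $\lim_{n\to\infty}\sqrt[n]{\sigma_n}=0$, so that $f$ is entire on the whole complex plane with probability one. Then both characteristics of the random Gaussian function $f$, its order $\rho[f]$ and its type $\beta[f]$, are almost everywhere non-random and may be calculated respectively by the relations $$\rho[f]=\limsup_{n\to\infty}\left\{\frac{n\,\ln n}{|\ln\sigma_n|}\right\},$$ $$\beta[f]=\limsup_{n\to\infty}\left\{n^{1/\rho[f]}\,\sqrt[n]{\sigma_n}\right\}.$$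
   Context: The random variables $\xi_k=\eta_k+i\zeta_k$ ($i^2=-1$) are defined on some sufficiently rich probability space; $\eta_k$ and $\zeta_k$ are real valued and have mean zero. The $\xi_k$ are not necessarily independent, and in general $\eta_k$ and $\zeta_k$ may also be dependent. For an entire function $g$ put $M_g(r)=\sup_{|z|=r}|g(z)|=\sup_{|z|\le r}|g(z)|$. The order of $g$ is $$\rho[g]=\limsup_{r\to\infty}\frac{\ln\ln M_g(r)}{\ln r},$$ and the type of $g$ is $$\beta[g]=\limsup_{r\to\infty}\frac{\ln M_g(r)}{r^{\rho[g]}}.$$
   Formalization: The type formula as printed is false (σ_n = 1/n! gives ρ = β = 1 but limsup e); proved instead, for 0 < ρ < ∞ where it is defined: β[f] = limsup (n^{1/ρ} σ_n^{1/n})^ρ / (eρ). "Gaussian" means real and imaginary parts jointly Gaussian. *)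

theory Defs
  imports "HOL-Probability.Probability"
begin

definition centered_gaussian :: "'a measure \<Rightarrow> ('a \<Rightarrow> real) \<Rightarrow> bool" where
  "centered_gaussian M X \<longleftrightarrow>
     X \<in> borel_measurable M \<and>
     ((AE \<omega> in M. X \<omega> = 0) \<or> (\<exists>s>0. distributed M lborel X (normal_density 0 s)))"

(* Real and imaginary part are jointly Gaussian; they may be dependent, and either or both may
   be degenerate (variance 0). *)
definition complex_centered_gaussian :: "'a measure \<Rightarrow> ('a \<Rightarrow> complex) \<Rightarrow> bool" where
  "complex_centered_gaussian M Z \<longleftrightarrow>
     (\<forall>a b :: real. centered_gaussian M (\<lambda>\<omega>. a * Re (Z \<omega>) + b * Im (Z \<omega>)))"

definition complex_sd :: "'a measure \<Rightarrow> ('a \<Rightarrow> complex) \<Rightarrow> real" where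
  "complex_sd M Z =
     sqrt ((\<integral>\<omega>. (Re (Z \<omega>))\<^sup>2 \<partial>M) + (\<integral>\<omega>. (Im (Z \<omega>))\<^sup>2 \<partial>M))"

definition random_power_series :: "(nat \<Rightarrow> 'a \<Rightarrow> complex) \<Rightarrow> 'a \<Rightarrow> complex \<Rightarrow> complex" where
  "random_power_series \<xi> \<omega> z = (\<Sum>k. \<xi> k \<omega> * z ^ k)"

definition max_modulus :: "(complex \<Rightarrow> complex) \<Rightarrow> real \<Rightarrow> real" where
  "max_modulus g r = (SUP z\<in>sphere 0 r. norm (g z))"

(* Constant functions, for which the double logarithm may be meaningless, get order 0. *)
definition entire_order :: "(complex \<Rightarrow> complex) \<Rightarrow> ereal" where
  "entire_order g =
     Limsup at_top (\<lambda>r::real. ereal (ln (ln (max_modulus g r)) / ln r))"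

(* Only meaningful for functions of order strictly between 0 and infinity. *)
definition entire_type :: "(complex \<Rightarrow> complex) \<Rightarrow> ereal" where
  "entire_type g =
     Limsup at_top (\<lambda>r::real. ereal (ln (max_modulus g r) / r powr real_of_ereal (entire_order g)))"

(* A term with s n = 0 stands for n ln n / infinity = 0, which agrees with ln 0 = 0 and x / 0 = 0. *)
definition order_formula :: "(nat \<Rightarrow> real) \<Rightarrow> ereal" where
  "order_formula s = limsup (\<lambda>n. ereal (real n * ln (real n) / \<bar>ln (s n)\<bar>))"

(* With the type normalised as in entire_type, the limsup L of n^(1/rho) * (s n)^(1/n) is
   (e * rho * type)^(1/rho) and not the type itself: for exp, rho = type = 1 but L = e.
   The formula is therefore type = L^rho / (e * rho), with the increasing map
   x |-> x^rho / (e * rho) applied inside the limsup, so that L = infinity is covered. *)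
definition type_formula :: "real \<Rightarrow> (nat \<Rightarrow> real) \<Rightarrow> ereal" where
  "type_formula \<rho> s =
     limsup (\<lambda>n. ereal ((real n powr (1 / \<rho>) * root n (s n)) powr \<rho> / (exp 1 * \<rho>)))"

end

theory Submission
  imports Defs "HOL-Complex_Analysis.Complex_Analysis" "HOL-Real_Asymp.Real_Asymp"
begin

text \<open>
  Randomness affects each coefficient by at most a polynomial factor, and neither the order nor
  the type notices such a factor. A centered Gaussian variable is neither much larger nor much
  smaller than its standard deviation: \<open>\<bar>\<xi>\<^sub>n\<bar> > n \<sigma>\<^sub>n\<close> has probability at most \<open>1/n\<^sup>2\<close> by Chebyshev's
  inequality, and \<open>\<bar>\<xi>\<^sub>n\<bar> < \<sigma>\<^sub>n/n\<^sup>2\<close> has probability at most \<open>2/n\<^sup>2\<close> because the Gaussian density is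
  bounded. Both series converge, so by the direct half of the Borel-Cantelli lemma, which holds
  for dependent events too, almost surely \<open>\<sigma>\<^sub>n/n\<^sup>2 \<le> \<bar>\<xi>\<^sub>n\<bar> \<le> n \<sigma>\<^sub>n\<close> for all large \<open>n\<close>
  (\<open>AE_eventually_gaussian_sandwich\<close>).

  What remains is the classical relation between the growth of an entire function and the decay
  of its coefficients, in a form with room for these factors
  (\<open>order_and_type\<close>). Its pivot is the number
  \<open>w\<^sub>n = (e B p / n)\<^bsup>n/p\<^esup>\<close>, which is the minimum of \<open>exp(B r\<^sup>p) / r\<^sup>n\<close> over \<open>r > 0\<close>. If the maximum
  modulus is at most \<open>exp(B r\<^sup>p)\<close> for large \<open>r\<close>, Cauchy's inequality at the minimising radius
  gives \<open>\<bar>a\<^sub>n\<bar> \<le> w\<^sub>n\<close> for large \<open>n\<close>. Conversely, let \<open>\<bar>a\<^sub>n\<bar> \<le> n w\<^sub>n\<close> for large \<open>n\<close> and let \<open>B' > B\<close>.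
  Passing from \<open>B\<close> to \<open>B'\<close> multiplies \<open>w\<^sub>n\<close> by a growing geometric factor, so the quotients of
  \<open>\<bar>a\<^sub>n\<bar>\<close> by the numbers belonging to \<open>B'\<close> are summable, and the maximum modulus is \<open>O(exp(B' r\<^sup>p))\<close>.

  The two formulas are read off from the same numbers. If \<open>\<sigma>\<^sub>n \<le> n\<^sup>2 w\<^sub>n\<close> for large \<open>n\<close>, then the order
  formula is at most \<open>p\<close> and the type formula for \<open>p\<close> is at most \<open>B\<close>. Conversely, a type formula below
  \<open>B\<close> gives \<open>\<sigma>\<^sub>n \<le> w\<^sub>n\<close> for large \<open>n\<close>, and so does an order formula below \<open>p\<close> when
  \<open>B = 1 / (e p)\<close>. Comparing both sides of the asserted equations with arbitrary real bounds gives
  the inequalities in both directions.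
\<close>

section \<open>Extremal coefficients for a prescribed growth\<close>

text \<open>The number \<open>(e B p / n)\<^bsup>n/p\<^esup>\<close>. The exponential form gives the value \<open>1\<close> at \<open>n = 0\<close>, which is the
  limit value; written as a real power, the term would be \<open>0\<close> there.\<close>

definition coeff_weight :: "real \<Rightarrow> real \<Rightarrow> nat \<Rightarrow> real" where
  "coeff_weight B p n = exp (real n / p * (1 + ln (B * p) - ln (real n)))"

lemma coeff_weight_pos: "coeff_weight B p n > 0"
  by (simp add: coeff_weight_def)

text \<open>In terms of \<open>x = B p r\<^sup>p / n\<close> this is the inequality \<open>ln x \<le> x - 1\<close>, multiplied by \<open>n / p\<close>.\<close>

lemma coeff_weight_mult_power_le:
  assumes "B > 0" "p > 0" "r > 0"
  shows "coeff_weight B p n * r ^ n \<le> exp (B * r powr p)"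
proof (cases "n = 0")
  case True
  then show ?thesis using assms by (simp add: coeff_weight_def)
next
  case False
  define x where "x = B * p * r powr p / real n"
  have "x > 0" using assms False by (simp add: x_def)
  then have "ln x \<le> x - 1" by (rule ln_le_minus_one)
  moreover have "ln x = ln (B * p) + p * ln r - ln (real n)"
    using assms False by (simp add: x_def ln_div ln_mult ln_powr)
  ultimately have "1 + ln (B * p) - ln (real n) + p * ln r \<le> x" by simp
  then have "real n / p * (1 + ln (B * p) - ln (real n) + p * ln r) \<le> real n / p * x"
    using assms by (intro mult_left_mono) auto
  also have "real n / p * x = B * r powr p" using assms False by (simp add: x_def)
  finally have "real n / p * (1 + ln (B * p) - ln (real n)) + real n * ln r \<le> B * r powr p"
    using assms by (simp add: field_simps)
  moreover have "r ^ n = exp (real n * ln r)"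
    using assms by (simp add: exp_of_nat_mult)
  ultimately show ?thesis by (simp add: coeff_weight_def flip: exp_add)
qed

text \<open>The bound above is attained where \<open>ln x = x - 1\<close>, that is at \<open>x = 1\<close>.\<close>

lemma coeff_weight_mult_power_eq:
  assumes "B > 0" "p > 0" "n > 0" "r = (real n / (B * p)) powr (1 / p)"
  shows "coeff_weight B p n * r ^ n = exp (B * r powr p)"
proof -
  have rp: "r > 0" using assms by simp
  have "r powr p = real n / (B * p)" using assms by (simp add: powr_powr)
  then have "B * r powr p = real n / p" using assms(1-3) by simp
  moreover have "ln r = (ln (real n) - ln (B * p)) / p"
    using assms by (simp add: ln_div)
  ultimately have
    "real n / p * (1 + ln (B * p) - ln (real n)) + real n * ln r = B * r powr p"
    using assms(1-3) by (simp add: right_diff_distrib distrib_left diff_divide_distrib)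
  moreover have "r ^ n = exp (real n * ln r)"
    using rp by (simp add: exp_of_nat_mult)
  ultimately show ?thesis by (simp add: coeff_weight_def flip: exp_add)
qed

lemma coeff_weight_geometric:
  assumes "B > 0" "B' > 0" "p > 0"
  shows "coeff_weight B p n = coeff_weight B' p n * ((B / B') powr (1 / p)) ^ n"
proof -
  have "((B / B') powr (1 / p)) ^ n = exp (real n * ln ((B / B') powr (1 / p)))"
    using assms by (simp add: powr_def flip: exp_of_nat_mult)
  also have "ln ((B / B') powr (1 / p)) = (ln B - ln B') / p"
    using assms by (simp add: ln_powr ln_div)
  finally show ?thesis using assms
    by (simp add: coeff_weight_def ln_mult field_simps flip: exp_add)
qed

section \<open>Order and type formulas in terms of the extremal coefficients\<close>

text \<open>With \<open>B = 1 / (e \<mu>)\<close> the weight is just \<open>n\<^bsup>-n/\<mu>\<^esup>\<close>, and \<open>s\<^sub>n \<le> n\<^bsup>-n/\<mu>\<^esup>\<close> is a rearrangement of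
  \<open>n ln n / \<bar>ln s\<^sub>n\<bar> \<le> \<mu>\<close> once \<open>s\<^sub>n < 1\<close> makes the logarithm negative.\<close>

lemma eventually_le_coeff_weight_if_order_formula_less:
  assumes "order_formula s < ereal \<mu>" "\<mu> > 0" "\<And>n. s n \<ge> 0"
    and "(\<lambda>n. root n (s n)) \<longlonglongrightarrow> 0"
  shows "eventually (\<lambda>n. s n \<le> coeff_weight (1 / (exp 1 * \<mu>)) \<mu> n) sequentially"
proof -
  have "eventually (\<lambda>n. ereal (real n * ln (real n) / \<bar>ln (s n)\<bar>) < ereal \<mu>) sequentially"
    using assms(1) unfolding order_formula_def by (rule Limsup_lessD)
  moreover have "eventually (\<lambda>n. root n (s n) < 1) sequentially"
    using assms(4) by (rule order_tendstoD) simp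
  ultimately show ?thesis using eventually_gt_at_top[of 1]
  proof eventually_elim
    case (elim n)
    show ?case
    proof (cases "s n = 0")
      case True
      then show ?thesis using less_imp_le[OF coeff_weight_pos] by simp
    next
      case False
      then have sp: "s n > 0" using assms(3)[of n] by simp
      have "s n < 1" using elim by simp
      then have l: "ln (s n) < 0" using sp by simp
      then have "real n * ln (real n) < - (\<mu> * ln (s n))"
        using elim(1) by (simp add: field_simps)
      then have "ln (s n) < - (real n * ln (real n) / \<mu>)"
        using assms(2) by (simp add: field_simps)
      also have "\<dots> = ln (coeff_weight (1 / (exp 1 * \<mu>)) \<mu> n)"
        using assms(2) by (simp add: coeff_weight_def ln_div)
      finally show ?thesis using sp coeff_weight_pos by (metis less_imp_le ln_less_cancel_iff)
    qed
  qed
qed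

text \<open>Only the leading term \<open>(n/\<mu>) ln n\<close> of \<open>- ln s\<^sub>n\<close> matters: neither the constant \<open>B\<close>, which contributes
  \<open>O(n)\<close>, nor the factor \<open>n\<^sup>2\<close>, which contributes \<open>O(ln n)\<close>, survives in the limit.\<close>

lemma order_formula_le:
  assumes "B > 0" "\<mu> > 0" "\<And>n. s n \<ge> 0"
    and "eventually (\<lambda>n. s n \<le> (real n)\<^sup>2 * coeff_weight B \<mu> n) sequentially"
  shows "order_formula s \<le> ereal \<mu>"
proof -
  define c where "c = 1 + ln (B * \<mu>)"
  define D where "D = (\<lambda>n::nat. real n / \<mu> * (ln (real n) - c) - 2 * ln (real n))"
  have D: "eventually (\<lambda>n. D n > 0) sequentially"
    using assms(2) unfolding D_def by real_asymp
  have g: "(\<lambda>n. real n * ln (real n) / D n) \<longlonglongrightarrow> \<mu>"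
    using assms(2) unfolding D_def by real_asymp
  have "eventually (\<lambda>n. ereal (real n * ln (real n) / \<bar>ln (s n)\<bar>)
          \<le> ereal (real n * ln (real n) / D n)) sequentially"
    using assms(4) D eventually_gt_at_top[of 1]
  proof eventually_elim
    case (elim n)
    show ?case
    proof (cases "s n = 0")
      case True
      then show ?thesis using elim by simp
    next
      case False
      then have sp: "s n > 0" using assms(3)[of n] by simp
      have "ln (s n) \<le> ln ((real n)\<^sup>2 * coeff_weight B \<mu> n)"
        using sp elim(1) by simp
      also have "\<dots> = - D n"
        using elim by (simp add: ln_mult coeff_weight_def ln_realpow D_def c_def algebra_simps)
      finally have "D n \<le> \<bar>ln (s n)\<bar>" by simp
      then show ?thesis using elim by (auto intro!: divide_left_mono)
    qed
  qed
  then have "order_formula s \<le> limsup (\<lambda>n. ereal (real n * ln (real n) / D n))"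
    unfolding order_formula_def by (rule Limsup_mono)
  also have "\<dots> = ereal \<mu>" using g by (intro lim_imp_Limsup) auto
  finally show ?thesis .
qed

lemma type_formula_term_eq:
  assumes "n > 0" "s > 0" "p > 0"
  shows "(real n powr (1 / p) * root n s) powr p / (exp 1 * p)
           = exp (ln (real n) + p / real n * ln s - 1 - ln p)"
proof -
  have "(real n powr (1 / p) * root n s) powr p / (exp 1 * p)
      = exp (ln ((real n powr (1 / p) * root n s) powr p / (exp 1 * p)))"
    by (subst exp_ln) (use assms in simp_all)
  also have "ln ((real n powr (1 / p) * root n s) powr p / (exp 1 * p))
      = ln (real n) + p / real n * ln s - 1 - ln p"
    using assms by (simp add: ln_div ln_mult ln_powr ln_root field_simps)
  finally show ?thesis .
qed

text \<open>The \<open>n\<close>-th term of the type formula is \<open>n s\<^sub>n\<^bsup>p/n\<^esup> / (e p)\<close>, and solving the condition that it is at most \<open>B\<close> for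
  \<open>s\<^sub>n\<close> gives exactly the weight.\<close>

lemma eventually_le_coeff_weight_if_type_formula_less:
  assumes "type_formula p s < ereal B" "B > 0" "p > 0" "\<And>n. s n \<ge> 0"
  shows "eventually (\<lambda>n. s n \<le> coeff_weight B p n) sequentially"
proof -
  have "eventually (\<lambda>n. ereal ((real n powr (1 / p) * root n (s n)) powr p / (exp 1 * p)) < ereal B)
          sequentially"
    using assms(1) unfolding type_formula_def by (rule Limsup_lessD)
  then show ?thesis using eventually_gt_at_top[of 0]
  proof eventually_elim
    case (elim n)
    show ?case
    proof (cases "s n = 0")
      case True
      then show ?thesis using less_imp_le[OF coeff_weight_pos] by simp
    next
      case False
      then have sp: "s n > 0" using assms(4)[of n] by simp
      have "exp (ln (real n) + p / real n * ln (s n) - 1 - ln p) < B"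
        using elim(1) by (simp only: type_formula_term_eq[OF elim(2) sp \<open>p > 0\<close>] less_ereal.simps)
      then have "ln (real n) + p / real n * ln (s n) - 1 - ln p < ln B"
        using assms(2) by (metis exp_less_cancel_iff exp_ln)
      then have "ln (s n) < real n / p * (1 + ln B + ln p - ln (real n))"
        using assms elim by (simp add: field_simps)
      also have "\<dots> = ln (coeff_weight B p n)"
        using assms by (simp add: coeff_weight_def ln_mult add_ac)
      finally show ?thesis using sp coeff_weight_pos by (metis less_imp_le ln_less_cancel_iff)
    qed
  qed
qed

text \<open>In the terms of the type formula the factor \<open>n\<^sup>2\<close> becomes \<open>n\<^bsup>2p/n\<^esup>\<close>, which tends to \<open>1\<close>.\<close>

lemma type_formula_le:
  assumes "B > 0" "p > 0" "\<And>n. s n \<ge> 0"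
    and "eventually (\<lambda>n. s n \<le> (real n)\<^sup>2 * coeff_weight B p n) sequentially"
  shows "type_formula p s \<le> ereal B"
proof -
  define g where "g = (\<lambda>n::nat. exp (2 * p * ln (real n) / real n + ln B))"
  have "(\<lambda>n::nat. 2 * p * ln (real n) / real n + ln B) \<longlonglongrightarrow> ln B"
    using assms(2) by real_asymp
  then have "g \<longlonglongrightarrow> exp (ln B)" unfolding g_def by (rule tendsto_exp)
  then have g: "g \<longlonglongrightarrow> B" using assms by simp
  have "eventually (\<lambda>n. ereal ((real n powr (1 / p) * root n (s n)) powr p / (exp 1 * p))
          \<le> ereal (g n)) sequentially"
    using assms(4) eventually_gt_at_top[of 0]
  proof eventually_elim
    case (elim n)
    show ?case
    proof (cases "s n = 0")
      case True
      then show ?thesis by (simp add: g_def)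
    next
      case False
      then have sp: "s n > 0" using assms(3)[of n] by simp
      have "ln (s n) \<le> ln ((real n)\<^sup>2 * coeff_weight B p n)"
        using sp elim(1) by simp
      also have "\<dots> = 2 * ln (real n) + real n / p * (1 + ln B + ln p - ln (real n))"
        using elim assms by (simp add: ln_mult coeff_weight_def ln_realpow add_ac)
      finally have "p / real n * ln (s n)
          \<le> p / real n * (2 * ln (real n) + real n / p * (1 + ln B + ln p - ln (real n)))"
        using assms(2) by (intro mult_left_mono) auto
      also have "\<dots> = 2 * p * ln (real n) / real n + (1 + ln B + ln p - ln (real n))"
        using assms(2) elim by (simp add: distrib_left)
      finally have "ln (real n) + p / real n * ln (s n) - 1 - ln p
          \<le> 2 * p * ln (real n) / real n + ln B" by simp
      then show ?thesis
        using type_formula_term_eq[OF elim(2) sp \<open>p > 0\<close>] by (simp add: g_def)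
    qed
  qed
  then have "type_formula p s \<le> limsup (\<lambda>n. ereal (g n))"
    unfolding type_formula_def by (rule Limsup_mono)
  also have "\<dots> = ereal B" using g by (intro lim_imp_Limsup) auto
  finally show ?thesis .
qed

lemma order_formula_nonneg: "0 \<le> order_formula s"
proof -
  have "0 \<le> ln (real n)" for n by (cases n) auto
  then show ?thesis unfolding order_formula_def
    by (intro le_Limsup always_eventually) auto
qed

lemma type_formula_nonneg: "p > 0 \<Longrightarrow> 0 \<le> type_formula p s"
  unfolding type_formula_def
  by (intro le_Limsup always_eventually) auto

lemma order_formula_eq_0_if_eventually_0:
  assumes "eventually (\<lambda>n. s n = 0) sequentially"
  shows "order_formula s = 0"
proof -
  have "order_formula s \<le> 0"
    unfolding order_formula_def
    by (rule Limsup_bounded) (use assms in eventually_elim, simp)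
  then show ?thesis using order_formula_nonneg[of s] by simp
qed

section \<open>Coefficients and growth of an entire function\<close>

locale entire_series =
  fixes a :: "nat \<Rightarrow> complex"
  assumes summable_everywhere: "summable (\<lambda>k. a k * z ^ k)"
begin

definition f :: "complex \<Rightarrow> complex" where "f z = (\<Sum>k. a k * z ^ k)"

lemma f_eq_eval_fps: "f = eval_fps (Abs_fps a)"
  by (simp add: f_def eval_fps_def fun_eq_iff)

lemma conv_radius_infinite: "fps_conv_radius (Abs_fps a) = \<infinity>"
  unfolding fps_conv_radius_def
  using conv_radius_geI_ex'[of \<infinity> a] summable_everywhere
  by simp

lemma holomorphic: "f holomorphic_on A"
  unfolding f_eq_eval_fps by (rule holomorphic_on_eval_fps) (simp add: conv_radius_infinite)

lemma higher_deriv_0: "(deriv ^^ n) f 0 / fact n = a n"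
proof -
  have "f has_fps_expansion Abs_fps a"
    unfolding f_eq_eval_fps by (rule eval_fps_has_fps_expansion) (simp add: conv_radius_infinite)
  from fps_nth_fps_expansion[OF this, of n] show ?thesis by simp
qed

lemma norm_le_max_modulus: "norm z = r \<Longrightarrow> norm (f z) \<le> max_modulus f r"
  unfolding max_modulus_def
proof (rule cSUP_upper)
  have "continuous_on (sphere 0 r) (\<lambda>z. norm (f z))"
    using holomorphic by (intro continuous_intros holomorphic_on_imp_continuous_on)
  then have "compact ((\<lambda>z. norm (f z)) ` sphere 0 r)"
    by (intro compact_continuous_image) auto
  then show "bdd_above ((\<lambda>z. norm (f z)) ` sphere 0 r)"
    by (intro bounded_imp_bdd_above compact_imp_bounded)
qed simp

lemma max_modulus_nonneg: "r > 0 \<Longrightarrow> 0 \<le> max_modulus f r"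
  using order_trans[OF norm_ge_zero norm_le_max_modulus[of "of_real r" r]] by simp

text \<open>Cauchy's inequality for the Taylor coefficients at \<open>0\<close>.\<close>

lemma coeff_le_max_modulus:
  assumes "r > 0"
  shows "norm (a n) * r ^ n \<le> max_modulus f r"
proof -
  have "norm ((deriv ^^ n) f 0) \<le> fact n * max_modulus f r / r ^ n"
    using assms by (intro Cauchy_inequality holomorphic_on_imp_continuous_on holomorphic
        norm_le_max_modulus) auto
  then have "norm ((deriv ^^ n) f 0 / fact n) * r ^ n \<le> max_modulus f r"
    using assms by (simp add: norm_divide field_simps)
  then show ?thesis by (simp only: higher_deriv_0)
qed

text \<open>The gap between \<open>B\<close> and \<open>B'\<close> provides a geometric factor \<open>q\<^sup>n\<close> with \<open>q < 1\<close>, which absorbs the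
  factor \<open>n\<close> and makes \<open>\<bar>a\<^sub>n\<bar> / w\<^sub>n\<close> summable, \<open>w\<^sub>n\<close> being the weight for \<open>B'\<close>. Each term
  \<open>\<bar>a\<^sub>n\<bar> r\<^sup>n = (\<bar>a\<^sub>n\<bar> / w\<^sub>n) (w\<^sub>n r\<^sup>n)\<close> is then at most \<open>\<bar>a\<^sub>n\<bar> / w\<^sub>n\<close> times \<open>exp(B' r\<^sup>p)\<close>.\<close>

lemma max_modulus_le_exp:
  assumes "0 < B" "B < B'" "p > 0"
    and "eventually (\<lambda>n. norm (a n) \<le> real n * coeff_weight B p n) sequentially"
  shows "\<exists>C>0. \<forall>r>0. max_modulus f r \<le> C * exp (B' * r powr p)"
proof -
  have "B' > 0" using assms by simp
  let ?w = "coeff_weight B' p"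
  define q where "q = (B / B') powr (1 / p)"
  have q: "0 < q" "q < 1" using assms powr_less_mono2[of "1 / p" "B / B'" 1] by (auto simp: q_def)
  have "summable (\<lambda>n. norm (a n) / ?w n)"
  proof (rule summable_comparison_test_ev)
    show "summable (\<lambda>n. real n * q ^ n)"
    proof (rule summable_comparison_test')
      show "summable (\<lambda>n. of_nat (Suc n) * q ^ n)"
        using geometric_deriv_sums[of q] q by (auto intro: sums_summable)
      show "norm (real n * q ^ n) \<le> of_nat (Suc n) * q ^ n" for n
        using q by (simp add: mult_right_mono)
    qed
    show "eventually (\<lambda>n. norm (norm (a n) / ?w n) \<le> real n * q ^ n) sequentially"
      using assms(4)
    proof eventually_elim
      case (elim n)
      have "coeff_weight B p n = ?w n * q ^ n"
        unfolding q_def using assms by (intro coeff_weight_geometric) auto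
      then show ?case using elim coeff_weight_pos[of B' p n] by (simp add: field_simps)
    qed
  qed
  note sw = this
  define C where "C = (\<Sum>n. norm (a n) / ?w n) + 1"
  have "0 \<le> (\<Sum>n. norm (a n) / ?w n)"
    using sw by (intro suminf_nonneg) (auto simp: less_imp_le[OF coeff_weight_pos])
  then have "C > 0" by (simp add: C_def)
  moreover have "max_modulus f r \<le> C * exp (B' * r powr p)" if r: "r > 0" for r
    unfolding max_modulus_def
  proof (rule cSUP_least)
    show "sphere 0 r \<noteq> ({} :: complex set)" using r by simp
    fix z :: complex assume "z \<in> sphere 0 r"
    then have z: "norm z = r" by simp
    let ?E = "exp (B' * r powr p)"
    have le: "norm (a n * z ^ n) \<le> norm (a n) / ?w n * ?E" for n
    proof -
      have "norm (a n * z ^ n) = norm (a n) / ?w n * (?w n * r ^ n)"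
        using coeff_weight_pos[of B' p n] by (simp add: norm_mult norm_power z)
      also have "\<dots> \<le> norm (a n) / ?w n * ?E"
        using r assms \<open>B' > 0\<close> coeff_weight_pos[of B' p n]
        by (intro mult_left_mono coeff_weight_mult_power_le) auto
      finally show ?thesis .
    qed
    have s2: "summable (\<lambda>n. norm (a n) / ?w n * ?E)" using sw by (rule summable_mult2)
    have "norm (f z) \<le> (\<Sum>n. norm (a n) / ?w n * ?E)"
      unfolding f_def using le s2 by (rule norm_suminf_le)
    also have "\<dots> = (C - 1) * ?E" unfolding C_def using sw by (simp add: suminf_mult2)
    also have "\<dots> \<le> C * ?E" by (intro mult_right_mono) auto
    finally show "norm (f z) \<le> C * ?E" .
  qed
  ultimately show ?thesis by blast
qed

text \<open>Cauchy's inequality is applied at the radius where \<open>exp(B r\<^sup>p) / r\<^sup>n\<close> is minimal; this radius tends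
  to infinity with \<open>n\<close>, so the growth bound is available there for large \<open>n\<close>.\<close>

lemma eventually_coeff_le_coeff_weight:
  assumes "B > 0" "p > 0"
    and "eventually (\<lambda>r. ln (max_modulus f r) \<le> B * r powr p) at_top"
  shows "eventually (\<lambda>n. norm (a n) \<le> coeff_weight B p n) sequentially"
proof -
  have "filterlim (\<lambda>n::nat. (real n / (B * p)) powr (1 / p)) at_top sequentially"
    using assms(1,2) by real_asymp
  from eventually_compose_filterlim[OF assms(3) this] show ?thesis
    using eventually_gt_at_top[of 0]
  proof eventually_elim
    case (elim n)
    define r where "r = (real n / (B * p)) powr (1 / p)"
    have r: "r > 0" using assms elim by (simp add: r_def)
    have "max_modulus f r \<le> exp (B * r powr p)"
    proof (cases "max_modulus f r = 0")
      case False
      then have "max_modulus f r > 0" using max_modulus_nonneg[OF r] by simp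
      then show ?thesis using elim(1) by (metis r_def exp_le_cancel_iff exp_ln)
    qed simp
    then have "norm (a n) * r ^ n \<le> coeff_weight B p n * r ^ n"
      using coeff_le_max_modulus[OF r, of n] coeff_weight_mult_power_eq[OF assms(1,2) elim(2) r_def]
      by simp
    then show ?case using r by simp
  qed
qed

lemma max_modulus_at_top:
  assumes "n > 0" "a n \<noteq> 0"
  shows "filterlim (max_modulus f) at_top at_top"
proof (rule filterlim_at_top_mono)
  have "norm (a n) > 0" using assms by simp
  then show "filterlim (\<lambda>r. norm (a n) * r ^ n) at_top at_top"
    using assms(1) by real_asymp
  show "eventually (\<lambda>r. norm (a n) * r ^ n \<le> max_modulus f r) at_top"
    using eventually_gt_at_top[of 0] by eventually_elim (rule coeff_le_max_modulus)
qed

text \<open>The iterated logarithm of the maximum modulus is then constant, whatever its value, so dividing it by \<open>ln r\<close>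
  gives the limit \<open>0\<close>.\<close>

lemma order_const:
  assumes "\<And>n. n > 0 \<Longrightarrow> a n = 0"
  shows "entire_order f = 0"
proof -
  have "f z = a 0" for z
  proof -
    have "(\<lambda>k. a k * z ^ k) = (\<lambda>k. if k = 0 then a 0 else 0)" using assms by auto
    then show ?thesis unfolding f_def using suminf_finite[of "{0}" "\<lambda>k. if k = 0 then a 0 else 0"]
      by simp
  qed
  then have M: "max_modulus f r = norm (a 0)" if "r > 0" for r
    using that by (simp add: max_modulus_def)
  have "((\<lambda>r. ln (ln (norm (a 0))) / ln r) \<longlongrightarrow> 0) at_top" by real_asymp
  moreover have "eventually (\<lambda>r. ln (ln (norm (a 0))) / ln r = ln (ln (max_modulus f r)) / ln r) at_top"
    using eventually_gt_at_top[of 0] by eventually_elim (simp add: M)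
  ultimately have "((\<lambda>r. ln (ln (max_modulus f r)) / ln r) \<longlongrightarrow> 0) at_top"
    by (rule Lim_transform_eventually)
  then have "((\<lambda>r. ereal (ln (ln (max_modulus f r)) / ln r)) \<longlongrightarrow> ereal 0) at_top" by simp
  then show ?thesis unfolding entire_order_def
    by (subst lim_imp_Limsup) (auto simp: zero_ereal_def)
qed

lemma order_le:
  assumes M: "filterlim (max_modulus f) at_top at_top"
    and "B > 0" "p > 0" "C > 0" "\<And>r. r > 0 \<Longrightarrow> max_modulus f r \<le> C * exp (B * r powr p)"
  shows "entire_order f \<le> ereal p"
proof -
  have "eventually (\<lambda>r. max_modulus f r \<ge> exp 1) at_top"
    using M by (auto simp: filterlim_at_top)
  then have "eventually (\<lambda>r. ereal (ln (ln (max_modulus f r)) / ln r)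
      \<le> ereal (ln (ln C + B * r powr p) / ln r)) at_top"
    using eventually_gt_at_top[of 1]
  proof eventually_elim
    case (elim r)
    then have mp: "max_modulus f r > 0" using exp_gt_zero[of "1::real"] by linarith
    have l1: "ln (max_modulus f r) \<ge> 1" using elim mp by (simp add: ln_ge_iff)
    have "ln (max_modulus f r) \<le> ln (C * exp (B * r powr p))"
      using assms(5)[of r] elim mp by (intro ln_mono) auto
    also have "\<dots> = ln C + B * r powr p" using assms by (simp add: ln_mult)
    finally show ?case using l1 elim by (auto intro!: divide_right_mono ln_mono)
  qed
  then have "entire_order f \<le> Limsup at_top (\<lambda>r. ereal (ln (ln C + B * r powr p) / ln r))"
    unfolding entire_order_def by (rule Limsup_mono)
  also have "((\<lambda>r. ln (ln C + B * r powr p) / ln r) \<longlongrightarrow> p) at_top"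
    using assms(2,3) by real_asymp
  then have "Limsup at_top (\<lambda>r. ereal (ln (ln C + B * r powr p) / ln r)) = ereal p"
    by (intro lim_imp_Limsup) auto
  finally show ?thesis .
qed

lemma type_le:
  assumes M: "filterlim (max_modulus f) at_top at_top"
    and "entire_order f = ereal p"
    and "B > 0" "p > 0" "C > 0" "\<And>r. r > 0 \<Longrightarrow> max_modulus f r \<le> C * exp (B * r powr p)"
  shows "entire_type f \<le> ereal B"
proof -
  have "eventually (\<lambda>r. max_modulus f r \<ge> 1) at_top"
    using M by (auto simp: filterlim_at_top)
  then have "eventually (\<lambda>r. ereal (ln (max_modulus f r) / r powr p)
      \<le> ereal ((ln C + B * r powr p) / r powr p)) at_top"
    using eventually_gt_at_top[of 1]
  proof eventually_elim
    case (elim r)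
    have "ln (max_modulus f r) \<le> ln (C * exp (B * r powr p))"
      using assms(6)[of r] elim by (intro ln_mono) auto
    also have "\<dots> = ln C + B * r powr p" using assms by (simp add: ln_mult)
    finally show ?case by (simp add: divide_right_mono)
  qed
  then have "entire_type f \<le> Limsup at_top (\<lambda>r. ereal ((ln C + B * r powr p) / r powr p))"
    unfolding entire_type_def assms(2) real_of_ereal.simps by (rule Limsup_mono)
  also have "((\<lambda>r. (ln C + B * r powr p) / r powr p) \<longlongrightarrow> B) at_top"
    using assms(3,4) by real_asymp
  then have "Limsup at_top (\<lambda>r. ereal ((ln C + B * r powr p) / r powr p)) = ereal B"
    by (intro lim_imp_Limsup) auto
  finally show ?thesis .
qed

lemma order_nonneg: "0 \<le> entire_order f"
proof (cases "\<forall>n>0. a n = 0")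
  case True
  then show ?thesis using order_const by simp
next
  case False
  then have "filterlim (max_modulus f) at_top at_top" using max_modulus_at_top by blast
  then have "eventually (\<lambda>r. max_modulus f r \<ge> exp 1) at_top"
    by (auto simp: filterlim_at_top)
  then have "eventually (\<lambda>r. 0 \<le> ereal (ln (ln (max_modulus f r)) / ln r)) at_top"
    using eventually_gt_at_top[of 1]
  proof eventually_elim
    case (elim r)
    then have "max_modulus f r > 0" using exp_gt_zero[of "1::real"] by linarith
    then have "ln (max_modulus f r) \<ge> 1" using elim by (simp add: ln_ge_iff)
    then show ?case using elim by simp
  qed
  then show ?thesis unfolding entire_order_def by (intro le_Limsup) auto
qed

text \<open>Ensures that every real number above the type is positive, as a constant \<open>B\<close> in the extremal coefficients
  has to be.\<close>

lemma type_nonneg: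
  assumes M: "filterlim (max_modulus f) at_top at_top"
  shows "0 \<le> entire_type f"
proof -
  have "eventually (\<lambda>r. max_modulus f r \<ge> 1) at_top"
    using M by (auto simp: filterlim_at_top)
  then have "eventually (\<lambda>r. 0 \<le> ereal (ln (max_modulus f r) / r powr real_of_ereal (entire_order f))) at_top"
    by eventually_elim simp
  then show ?thesis unfolding entire_type_def by (intro le_Limsup) auto
qed

text \<open>The sequence \<open>s\<close> stands for the non-random comparison coefficients; polynomial factors
  between \<open>s\<close> and \<open>\<bar>a\<bar>\<close> are allowed in both directions. Each of the four inequalities takes a real number
  above the right-hand side, turns this into a bound by the weights or by \<open>exp(B r\<^sup>p)\<close>, and transfers it to the
  other side. Functions that are constant have to be treated apart, since their maximum modulus does not tend to
  infinity.\<close>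

theorem order_and_type:
  assumes s: "\<And>n. s n \<ge> 0" "(\<lambda>n. root n (s n)) \<longlonglongrightarrow> 0"
    and upper: "eventually (\<lambda>n. norm (a n) \<le> real n * s n) sequentially"
    and lower: "eventually (\<lambda>n. s n \<le> (real n)\<^sup>2 * norm (a n)) sequentially"
  shows "entire_order f = order_formula s"
    and "order_formula s = ereal p \<Longrightarrow> p > 0 \<Longrightarrow> entire_type f = type_formula p s"
proof -
  have upper': "eventually (\<lambda>n. norm (a n) \<le> real n * coeff_weight B p n) sequentially"
    if "eventually (\<lambda>n. s n \<le> coeff_weight B p n) sequentially" for B p
    using that upper
    by eventually_elim (meson order_trans mult_left_mono of_nat_0_le_iff)
  have lower': "eventually (\<lambda>n. s n \<le> (real n)\<^sup>2 * coeff_weight B p n) sequentially"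
    if "B > 0" "p > 0" "eventually (\<lambda>r. ln (max_modulus f r) \<le> B * r powr p) at_top" for B p
    using eventually_coeff_le_coeff_weight[OF that] lower
    by eventually_elim (meson order_trans mult_left_mono zero_le_power2)
  have const: "order_formula s = 0 \<and> entire_order f = 0" if "\<forall>n>0. a n = 0"
  proof
    have "eventually (\<lambda>n. s n = 0) sequentially"
      using lower eventually_gt_at_top[of 0]
      by eventually_elim (use that s(1) in \<open>force intro: antisym\<close>)
    then show "order_formula s = 0" by (rule order_formula_eq_0_if_eventually_0)
  qed (use that in \<open>auto intro: order_const\<close>)
  have le1: "order_formula s \<le> entire_order f"
  proof (rule dense_ge)
    fix y assume y: "entire_order f < y"
    show "order_formula s \<le> y"
    proof (cases y)
      case (real \<nu>)
      have "\<nu> > 0" using y real order_nonneg by (metis ereal_less(2) le_less_trans)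
      have "eventually (\<lambda>r. ereal (ln (ln (max_modulus f r)) / ln r) < ereal \<nu>) at_top"
        using y unfolding entire_order_def real by (rule Limsup_lessD)
      \<comment> \<open>The double logarithm carries information only where the inner logarithm is positive; elsewhere the bound is trivial.\<close>
      then have "eventually (\<lambda>r. ln (max_modulus f r) \<le> 1 * r powr \<nu>) at_top"
        using eventually_gt_at_top[of 1]
      proof eventually_elim
        case (elim r)
        show ?case
        proof (cases "ln (max_modulus f r) > 0")
          case True
          have "ln (ln (max_modulus f r)) < ln (r powr \<nu>)"
            using elim by (simp add: ln_powr field_simps)
          then show ?thesis using True elim by (subst (asm) ln_less_cancel_iff) auto
        next
          case False
          then show ?thesis using powr_ge_zero[of r \<nu>] by linarith
        qed
      qed
      then show ?thesis unfolding real
        using \<open>\<nu> > 0\<close> s by (intro order_formula_le[of 1] lower') auto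
    qed (use y in auto)
  qed
  have le2: "entire_order f \<le> order_formula s"
  proof (cases "\<forall>n>0. a n = 0")
    case False
    then have M: "filterlim (max_modulus f) at_top at_top" using max_modulus_at_top by blast
    show ?thesis
    proof (rule dense_ge)
      fix y assume y: "order_formula s < y"
      show "entire_order f \<le> y"
      proof (cases y)
        case (real \<mu>)
        have "\<mu> > 0" using y real order_formula_nonneg[of s]
          by (metis ereal_less(2) le_less_trans)
        \<comment> \<open>The order depends only on the exponent \<open>\<mu>\<close>, so enlarging the constant by \<open>1\<close> costs nothing.\<close>
        let ?B = "1 / (exp 1 * \<mu>)"
        have "eventually (\<lambda>n. norm (a n) \<le> real n * coeff_weight ?B \<mu> n) sequentially"
          using y real \<open>\<mu> > 0\<close> s
          by (intro upper' eventually_le_coeff_weight_if_order_formula_less) auto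
        then have "\<exists>C>0. \<forall>r>0. max_modulus f r \<le> C * exp ((?B + 1) * r powr \<mu>)"
          using \<open>\<mu> > 0\<close> by (intro max_modulus_le_exp[of ?B]) auto
        then obtain C where C: "C > 0" "\<And>r. r > 0 \<Longrightarrow> max_modulus f r \<le> C * exp ((?B + 1) * r powr \<mu>)"
          by blast
        show ?thesis unfolding real
          by (rule order_le[OF M _ \<open>\<mu> > 0\<close> C]) (use \<open>\<mu> > 0\<close> in \<open>auto intro: add_pos_pos\<close>)
      qed (use y in auto)
    qed
  qed (use const in simp)
  show ord: "entire_order f = order_formula s" using le1 le2 by (rule antisym[rotated])
  assume p: "order_formula s = ereal p" "p > 0"
  have "\<not> (\<forall>n>0. a n = 0)" using const p by (auto simp: zero_ereal_def)
  then have M: "filterlim (max_modulus f) at_top at_top" using max_modulus_at_top by blast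
  show "entire_type f = type_formula p s"
  proof (rule antisym)
    show "entire_type f \<le> type_formula p s"
    proof (rule dense_ge)
      fix y assume y: "type_formula p s < y"
      show "entire_type f \<le> y"
      proof (cases y)
        case (real B')
        obtain B where B: "type_formula p s < ereal B" "B < B'"
          using y real ereal_dense2[of "type_formula p s" y] by auto
        have "B > 0" using B(1) type_formula_nonneg[OF p(2), of s]
          by (metis ereal_less(2) le_less_trans)
        have "eventually (\<lambda>n. norm (a n) \<le> real n * coeff_weight B p n) sequentially"
          using B(1) p \<open>B > 0\<close> s
          by (intro upper' eventually_le_coeff_weight_if_type_formula_less) auto
        then obtain C where C: "C > 0" "\<And>r. r > 0 \<Longrightarrow> max_modulus f r \<le> C * exp (B' * r powr p)"
          using max_modulus_le_exp[OF \<open>B > 0\<close> B(2) p(2)] by blast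
        show ?thesis unfolding real
          by (rule type_le[OF M _ _ p(2) C]) (use p ord B(2) \<open>B > 0\<close> in auto)
      qed (use y in auto)
    qed
    show "type_formula p s \<le> entire_type f"
    proof (rule dense_ge)
      fix y assume y: "entire_type f < y"
      show "type_formula p s \<le> y"
      proof (cases y)
        case (real B)
        have "B > 0" using y real type_nonneg[OF M] by (metis ereal_less(2) le_less_trans)
        have "eventually (\<lambda>r. ereal (ln (max_modulus f r) / r powr p) < ereal B) at_top"
          using y unfolding entire_type_def real ord p(1) real_of_ereal.simps by (rule Limsup_lessD)
        then have "eventually (\<lambda>r. ln (max_modulus f r) \<le> B * r powr p) at_top"
          using eventually_gt_at_top[of 0] by eventually_elim (simp add: field_simps)
        then show ?thesis unfolding real using \<open>B > 0\<close> p s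
          by (intro type_formula_le lower') auto
      qed (use y in auto)
    qed
  qed
qed

end

section \<open>Sizes of Gaussian coefficients\<close>

lemma centered_gaussian_measurable: "centered_gaussian M X \<Longrightarrow> X \<in> borel_measurable M"
  by (simp add: centered_gaussian_def)

context prob_space
begin

lemma normal_square_integral:
  assumes s: "s > 0" and D: "distributed M lborel X (normal_density 0 s)"
  shows "integrable M (\<lambda>\<omega>. (X \<omega>)\<^sup>2)" and "expectation (\<lambda>\<omega>. (X \<omega>)\<^sup>2) = s\<^sup>2"
proof -
  show "integrable M (\<lambda>\<omega>. (X \<omega>)\<^sup>2)"
    using distributed_integrable[OF D, of "\<lambda>x. x\<^sup>2"] integrable_normal_moment[OF s, of 0 2] by simp
  show "expectation (\<lambda>\<omega>. (X \<omega>)\<^sup>2) = s\<^sup>2"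
    using normal_distributed_variance[OF s D] normal_distributed_expectation[OF s D] by simp
qed

lemma centered_gaussian_square_integrable:
  assumes "centered_gaussian M X"
  shows "integrable M (\<lambda>\<omega>. (X \<omega>)\<^sup>2)"
proof -
  have [measurable]: "X \<in> borel_measurable M"
    using assms by (rule centered_gaussian_measurable)
  consider "AE \<omega> in M. X \<omega> = 0" | s where "s > 0" "distributed M lborel X (normal_density 0 s)"
    using assms by (auto simp: centered_gaussian_def)
  then show ?thesis
  proof cases
    case 1
    have "integrable M (\<lambda>\<omega>. (X \<omega>)\<^sup>2) \<longleftrightarrow> integrable M (\<lambda>\<omega>. 0 :: real)"
      by (rule integrable_cong_AE) (use 1 in auto)
    then show ?thesis by simp
  qed (rule normal_square_integral)
qed

text \<open>A variable with positive second moment is not degenerate, and the normal density with standard deviation \<open>s\<close> is at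
  most \<open>1 / (s sqrt(2 \<pi>))\<close>. An interval of length \<open>2 t s\<close> therefore has probability at most
  \<open>2 t / sqrt(2 \<pi>) \<le> t\<close>.\<close>

lemma centered_gaussian_small_ball:
  assumes "centered_gaussian M X" "expectation (\<lambda>\<omega>. (X \<omega>)\<^sup>2) > 0" "t \<ge> 0"
  shows "prob {\<omega> \<in> space M. \<bar>X \<omega>\<bar> \<le> t * sqrt (expectation (\<lambda>\<omega>. (X \<omega>)\<^sup>2))} \<le> t"
proof -
  have [measurable]: "X \<in> borel_measurable M"
    using assms(1) by (rule centered_gaussian_measurable)
  have "\<not> (AE \<omega> in M. X \<omega> = 0)"
  proof
    assume "AE \<omega> in M. X \<omega> = 0"
    then have "expectation (\<lambda>\<omega>. (X \<omega>)\<^sup>2) = expectation (\<lambda>\<omega>. 0)"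
      by (intro integral_cong_AE) auto
    then show False using assms(2) by simp
  qed
  then obtain s where s: "s > 0" and D: "distributed M lborel X (normal_density 0 s)"
    using assms(1) by (auto simp: centered_gaussian_def)
  have sd: "sqrt (expectation (\<lambda>\<omega>. (X \<omega>)\<^sup>2)) = s"
    using normal_square_integral(2)[OF s D] s by simp
  define I where "I = {- (t * s)..t * s}"
  define c where "c = 1 / (s * sqrt (2 * pi))"
  have "c \<ge> 0" using s by (simp add: c_def)
  have "emeasure M (X -` I \<inter> space M) = (\<integral>\<^sup>+x. ennreal (normal_density 0 s x) * indicator I x \<partial>lborel)"
    using distributed_emeasure[OF D, of I] by (simp add: I_def)
  also have "\<dots> \<le> (\<integral>\<^sup>+x. ennreal c * indicator I x \<partial>lborel)"
  proof (intro nn_integral_mono mult_right_mono ennreal_leI)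
    fix x :: real
    have "sqrt (2 * pi * s\<^sup>2) = s * sqrt (2 * pi)"
      using s by (simp add: real_sqrt_mult)
    then show "normal_density 0 s x \<le> c"
      using s by (simp add: normal_density_def c_def divide_right_mono)
  qed simp
  also have "\<dots> = ennreal c * emeasure lborel I"
    by (simp add: nn_integral_cmult_indicator I_def)
  also have "\<dots> = ennreal (c * (2 * t * s))"
    using assms(3) s \<open>c \<ge> 0\<close> by (simp add: I_def ennreal_mult mult_ac)
  also have "\<dots> \<le> ennreal t"
  proof (rule ennreal_leI)
    have "2 \<le> sqrt (2 * pi)" using pi_gt3 by (intro real_le_rsqrt) simp
    then have "t * 2 \<le> t * sqrt (2 * pi)" using assms(3) by (intro mult_left_mono)
    then show "c * (2 * t * s) \<le> t" using s by (simp add: c_def field_simps)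
  qed
  finally have "prob (X -` I \<inter> space M) \<le> t"
    using assms(3) by (simp add: emeasure_eq_measure)
  moreover have "X -` I \<inter> space M = {\<omega> \<in> space M. \<bar>X \<omega>\<bar> \<le> t * s}"
    by (auto simp: I_def abs_le_iff)
  ultimately show ?thesis by (simp add: sd)
qed

lemma complex_centered_gaussian_parts:
  assumes "complex_centered_gaussian M Z"
  shows "centered_gaussian M (\<lambda>\<omega>. Re (Z \<omega>))" and "centered_gaussian M (\<lambda>\<omega>. Im (Z \<omega>))"
    and "Z \<in> borel_measurable M"
proof -
  have *: "centered_gaussian M (\<lambda>\<omega>. x * Re (Z \<omega>) + y * Im (Z \<omega>))" for x y
    using assms by (simp add: complex_centered_gaussian_def)
  show "centered_gaussian M (\<lambda>\<omega>. Re (Z \<omega>))" "centered_gaussian M (\<lambda>\<omega>. Im (Z \<omega>))"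
    using *[of 1 0] *[of 0 1] by simp_all
  then show "Z \<in> borel_measurable M"
    by (subst borel_measurable_complex_iff) (auto intro: centered_gaussian_measurable)
qed

lemma complex_sd_square:
  assumes "complex_centered_gaussian M Z"
  shows "integrable M (\<lambda>\<omega>. (norm (Z \<omega>))\<^sup>2)"
    and "expectation (\<lambda>\<omega>. (norm (Z \<omega>))\<^sup>2) = (complex_sd M Z)\<^sup>2"
proof -
  note parts = complex_centered_gaussian_parts[OF assms]
  note int = parts(1,2)[THEN centered_gaussian_square_integrable]
  show "integrable M (\<lambda>\<omega>. (norm (Z \<omega>))\<^sup>2)" 
    unfolding cmod_power2 using int by (rule Bochner_Integration.integrable_add)
  have "expectation (\<lambda>\<omega>. (norm (Z \<omega>))\<^sup>2)
      = expectation (\<lambda>\<omega>. (Re (Z \<omega>))\<^sup>2) + expectation (\<lambda>\<omega>. (Im (Z \<omega>))\<^sup>2)"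
    unfolding cmod_power2 using int by (rule Bochner_Integration.integral_add)
  then show "expectation (\<lambda>\<omega>. (norm (Z \<omega>))\<^sup>2) = (complex_sd M Z)\<^sup>2"
    by (simp add: complex_sd_def)
qed

text \<open>Chebyshev's inequality; a variable of variance zero vanishes almost everywhere.\<close>

lemma complex_gaussian_tail:
  assumes Z: "complex_centered_gaussian M Z" and "c > 0"
  shows "prob {\<omega> \<in> space M. norm (Z \<omega>) > c * complex_sd M Z} \<le> 1 / c\<^sup>2"
proof -
  let ?s = "complex_sd M Z"
  have [measurable]: "Z \<in> borel_measurable M" by (rule complex_centered_gaussian_parts[OF Z])
  have s0: "?s \<ge> 0" by (simp add: complex_sd_def)
  show ?thesis
  proof (cases "?s = 0")
    case True
    then have "AE \<omega> in M. (norm (Z \<omega>))\<^sup>2 = 0"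
      using integral_nonneg_eq_0_iff_AE[OF complex_sd_square(1)[OF Z]] complex_sd_square(2)[OF Z]
      by simp
    then have "prob {\<omega> \<in> space M. norm (Z \<omega>) > c * ?s} = 0"
      by (subst prob_Collect_eq_0) (auto simp: True)
    then show ?thesis by simp
  next
    case False
    then have p: "(c * ?s)\<^sup>2 > 0" using assms by simp
    have "prob {\<omega> \<in> space M. norm (Z \<omega>) > c * ?s} \<le> prob {\<omega> \<in> space M. (norm (Z \<omega>))\<^sup>2 \<ge> (c * ?s)\<^sup>2}"
      using s0 \<open>c > 0\<close> by (intro finite_measure_mono) (auto intro!: power_mono)
    also have "\<dots> \<le> expectation (\<lambda>\<omega>. (norm (Z \<omega>))\<^sup>2) / (c * ?s)\<^sup>2"
      using p complex_sd_square(1)[OF Z] by (intro integral_Markov_inequality_measure[of _ _ "{}"]) auto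
    also have "\<dots> = 1 / c\<^sup>2"
      using False by (simp add: complex_sd_square(2)[OF Z] power_mult_distrib)
    finally show ?thesis .
  qed
qed

text \<open>One of the real and imaginary parts carries at least half of the variance, so the bound for real Gaussian
  variables, applied to that part, suffices; the factor \<open>2\<close> covers the loss of \<open>sqrt 2\<close>.\<close>

lemma complex_gaussian_small_ball:
  assumes Z: "complex_centered_gaussian M Z" and "t \<ge> 0"
  shows "prob {\<omega> \<in> space M. norm (Z \<omega>) < t * complex_sd M Z} \<le> 2 * t"
proof -
  let ?s = "complex_sd M Z"
  note parts = complex_centered_gaussian_parts[OF Z]
  have [measurable]: "Z \<in> borel_measurable M" by (rule parts)
  have s0: "?s \<ge> 0" by (simp add: complex_sd_def)
  show ?thesis
  proof (cases "?s = 0")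
    case True
    then show ?thesis using assms(2) by simp
  next
    case False
    have "?s\<^sup>2 = expectation (\<lambda>\<omega>. (Re (Z \<omega>))\<^sup>2) + expectation (\<lambda>\<omega>. (Im (Z \<omega>))\<^sup>2)"
      by (simp add: complex_sd_def)
    then have "\<exists>X. centered_gaussian M X \<and> (\<forall>\<omega>. \<bar>X \<omega>\<bar> \<le> norm (Z \<omega>))
        \<and> expectation (\<lambda>\<omega>. (X \<omega>)\<^sup>2) \<ge> ?s\<^sup>2 / 2"
      using parts(1,2) abs_Re_le_cmod abs_Im_le_cmod
      by (cases "expectation (\<lambda>\<omega>. (Re (Z \<omega>))\<^sup>2) \<ge> ?s\<^sup>2 / 2") fastforce+
    then obtain X where X: "centered_gaussian M X" "\<And>\<omega>. \<bar>X \<omega>\<bar> \<le> norm (Z \<omega>)"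
      "expectation (\<lambda>\<omega>. (X \<omega>)\<^sup>2) \<ge> ?s\<^sup>2 / 2" by blast
    define v where "v = expectation (\<lambda>\<omega>. (X \<omega>)\<^sup>2)"
    have [measurable]: "X \<in> borel_measurable M" using X(1) by (rule centered_gaussian_measurable)
    have "?s\<^sup>2 > 0" using False by simp
    then have v: "v > 0" "?s\<^sup>2 \<le> 4 * v" using X(3) unfolding v_def by linarith+
    have "?s \<le> sqrt (4 * v)" using v(2) by (rule real_le_rsqrt)
    then have "?s \<le> 2 * sqrt v" by (simp add: real_sqrt_mult)
    then have "t * ?s \<le> t * (2 * sqrt v)" using \<open>t \<ge> 0\<close> by (rule mult_left_mono)
    then have le: "t * ?s \<le> 2 * t * sqrt v" by simp
    have "prob {\<omega> \<in> space M. norm (Z \<omega>) < t * ?s} \<le> prob {\<omega> \<in> space M. \<bar>X \<omega>\<bar> \<le> 2 * t * sqrt v}"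
    proof (rule finite_measure_mono)
      show "{\<omega> \<in> space M. norm (Z \<omega>) < t * ?s} \<subseteq> {\<omega> \<in> space M. \<bar>X \<omega>\<bar> \<le> 2 * t * sqrt v}"
        using X(2) le by (auto intro: less_imp_le dest: le_less_trans order.strict_trans2)
    qed simp
    also have "\<dots> \<le> 2 * t"
      using centered_gaussian_small_ball[OF X(1), of "2 * t"] v(1) \<open>t \<ge> 0\<close> by (simp add: v_def)
    finally show ?thesis .
  qed
qed

text \<open>The probabilities of the exceptional events are summable, so the direct half of the Borel-Cantelli lemma applies.
  The thresholds \<open>n\<close> and \<open>1/n\<^sup>2\<close> make these probabilities \<open>O(1/n\<^sup>2)\<close> while distorting the coefficients
  by polynomial factors only.\<close>

lemma AE_eventually_gaussian_sandwich:
  assumes "\<And>k. complex_centered_gaussian M (\<xi> k)"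
  shows "AE \<omega> in M. eventually (\<lambda>n. norm (\<xi> n \<omega>) \<le> real n * complex_sd M (\<xi> n)) sequentially
     \<and> eventually (\<lambda>n. complex_sd M (\<xi> n) \<le> (real n)\<^sup>2 * norm (\<xi> n \<omega>)) sequentially"
proof -
  let ?s = "\<lambda>n. complex_sd M (\<xi> n)"
  have [measurable]: "\<xi> n \<in> borel_measurable M" for n
    by (rule complex_centered_gaussian_parts[OF assms])
  define U where "U n = {\<omega> \<in> space M. norm (\<xi> n \<omega>) > real n * ?s n}" for n
  define L where "L n = {\<omega> \<in> space M. norm (\<xi> n \<omega>) < 1 / (real n)\<^sup>2 * ?s n}" for n
  have [measurable]: "U n \<in> sets M" "L n \<in> sets M" for n
    unfolding U_def L_def by measurable
  have sq: "summable (\<lambda>n. 1 / (real n)\<^sup>2)"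
    using inverse_power_summable[of 2, where 'a = real] by (simp add: field_simps)
  have "summable (\<lambda>n. prob (U n))"
  proof (rule summable_comparison_test'[OF sq])
    show "norm (prob (U n)) \<le> 1 / (real n)\<^sup>2" if "n \<ge> 1" for n
      using complex_gaussian_tail[OF assms, of "real n" n] that by (simp add: U_def)
  qed
  then have U: "AE \<omega> in M. eventually (\<lambda>n. \<omega> \<in> space M - U n) sequentially"
    by (intro borel_cantelli_AE1) (auto simp: emeasure_eq_measure)
  have "summable (\<lambda>n. prob (L n))"
  proof (rule summable_comparison_test'[OF summable_mult[OF sq, of 2]])
    show "norm (prob (L n)) \<le> 2 * (1 / (real n)\<^sup>2)" if "n \<ge> 1" for n
      using complex_gaussian_small_ball[OF assms, of "1 / (real n)\<^sup>2" n] by (simp add: L_def)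
  qed
  then have "AE \<omega> in M. eventually (\<lambda>n. \<omega> \<in> space M - L n) sequentially"
    by (intro borel_cantelli_AE1) (auto simp: emeasure_eq_measure)
  with U show ?thesis
  proof eventually_elim
    case (elim \<omega>)
    have "eventually (\<lambda>n. norm (\<xi> n \<omega>) \<le> real n * ?s n) sequentially"
      using elim(1) by eventually_elim (auto simp: U_def)
    moreover have "eventually (\<lambda>n. ?s n \<le> (real n)\<^sup>2 * norm (\<xi> n \<omega>)) sequentially"
      using elim(2) eventually_gt_at_top[of 0]
      by eventually_elim (auto simp: L_def field_simps)
    ultimately show ?case ..
  qed
qed

end

section \<open>Order and type of Gaussian entire functions\<close>

lemma entire_series_if_root_tendsto_0:
  fixes a :: "nat \<Rightarrow> complex"
  assumes "\<And>n. s n \<ge> 0" "(\<lambda>n. root n (s n)) \<longlonglongrightarrow> 0"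
    and "eventually (\<lambda>n. norm (a n) \<le> real n * s n) sequentially"
  shows "entire_series a"
proof
  fix z :: complex
  \<comment> \<open>Eventually \<open>s\<^sub>n \<bar>z\<bar>\<^sup>n < 2\<^sup>-\<^sup>n\<close>; the series with the additional factor \<open>n + 1\<close> still converges.\<close>
  have "summable (\<lambda>n. real (Suc n) * (1 / 2) ^ n)"
    using geometric_deriv_sums[of "1 / 2 :: real"] by (auto intro: sums_summable)
  then show "summable (\<lambda>k. a k * z ^ k)"
  proof (rule summable_comparison_test_ev[rotated])
    have "(\<lambda>n. root n (s n) * norm z) \<longlonglongrightarrow> 0"
      using assms(2) by (rule tendsto_mult_left_zero)
    then have "eventually (\<lambda>n. root n (s n) * norm z < 1 / 2) sequentially"
      by (rule order_tendstoD) simp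
    with assms(3) show "eventually (\<lambda>n. norm (a n * z ^ n) \<le> real (Suc n) * (1 / 2) ^ n) sequentially"
      using eventually_gt_at_top[of 0]
    proof eventually_elim
      case (elim n)
      have "norm (a n * z ^ n) \<le> real n * s n * norm z ^ n"
        using elim by (simp add: norm_mult norm_power mult_right_mono)
      also have "s n = root n (s n) ^ n" using elim assms(1) by simp
      also have "real n * root n (s n) ^ n * norm z ^ n = real n * (root n (s n) * norm z) ^ n"
        by (simp add: power_mult_distrib)
      also have "\<dots> \<le> real (Suc n) * (1 / 2) ^ n"
        using elim assms(1) by (intro mult_mono power_mono) auto
      finally show ?case .
    qed
  qed
qed

theorem theorem2p3:
  fixes M :: "'a measure" and \<xi> :: "nat \<Rightarrow> 'a \<Rightarrow> complex"
  assumes "prob_space M"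
    and "\<And>k. complex_centered_gaussian M (\<xi> k)"
    and "(\<lambda>n. root n (complex_sd M (\<xi> n))) \<longlonglongrightarrow> 0"
  shows "let f = random_power_series \<xi>;
             \<sigma> = (\<lambda>n. complex_sd M (\<xi> n));
             \<rho> = order_formula \<sigma>
         in (AE \<omega> in M.
               (\<forall>z. summable (\<lambda>k. \<xi> k \<omega> * z ^ k)) \<and>
               f \<omega> holomorphic_on UNIV \<and>
               entire_order (f \<omega>) = \<rho> \<and>
               (0 < \<rho> \<and> \<rho> < \<infinity> \<longrightarrow>
                  entire_type (f \<omega>) = type_formula (real_of_ereal \<rho>) \<sigma>))"
  unfolding Let_def
proof -
  define s where "s = (\<lambda>n. complex_sd M (\<xi> n))"
  have s: "\<And>n. s n \<ge> 0" "(\<lambda>n. root n (s n)) \<longlonglongrightarrow> 0"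
    using assms(3) by (simp_all add: s_def complex_sd_def)
  have "AE \<omega> in M. eventually (\<lambda>n. norm (\<xi> n \<omega>) \<le> real n * s n) sequentially
     \<and> eventually (\<lambda>n. s n \<le> (real n)\<^sup>2 * norm (\<xi> n \<omega>)) sequentially"
    unfolding s_def by (rule prob_space.AE_eventually_gaussian_sandwich[OF assms(1,2)])
  then show "AE \<omega> in M.
      (\<forall>z. summable (\<lambda>k. \<xi> k \<omega> * z ^ k)) \<and>
      random_power_series \<xi> \<omega> holomorphic_on UNIV \<and>
      entire_order (random_power_series \<xi> \<omega>) = order_formula (\<lambda>n. complex_sd M (\<xi> n)) \<and>
      (0 < order_formula (\<lambda>n. complex_sd M (\<xi> n)) \<and> order_formula (\<lambda>n. complex_sd M (\<xi> n)) < \<infinity> \<longrightarrow>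
        entire_type (random_power_series \<xi> \<omega>) =
          type_formula (real_of_ereal (order_formula (\<lambda>n. complex_sd M (\<xi> n)))) (\<lambda>n. complex_sd M (\<xi> n)))"
    unfolding s_def[symmetric]
  proof eventually_elim
    case (elim \<omega>)
    then interpret entire_series "\<lambda>k. \<xi> k \<omega>"
      using s by (intro entire_series_if_root_tendsto_0) auto
    have f: "random_power_series \<xi> \<omega> = f"
      by (simp add: fun_eq_iff random_power_series_def f_def)
    have "entire_type f = type_formula (real_of_ereal (order_formula s)) s"
      if "0 < order_formula s" "order_formula s < \<infinity>"
      using that order_and_type(2)[OF s _ _ ] elim by (cases "order_formula s") auto
    then show ?case
      using summable_everywhere holomorphic order_and_type(1)[OF s] elim unfolding f by blast
  qed
qed

end
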